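(* Let $(A,\cdot,\alpha)$ be a left Hom-pre-Jacobi-Jordan algebra. Then the product $x\star y=x\cdot y+y\cdot x$ (for $x,y\in A$) defines a Hom-Jacobi-Jordan algebra structure $(A,\star,\alpha)$ on $A$.
   Context: All vector spaces and algebras are over a ground field $\mathbb{K}$ of characteristic $0$. A Hom-algebra is a triple $(A,\mu,\alpha)$ where $A$ is a vector space, $\alpha:A\to A$ is linear and $\mu$ is a bilinear product on $A$; it is multiplicative if $\alpha(\mu(x,y))=\mu(\alpha(x),\alpha(y))$ for all $x,y$. A Hom-Jacobi-Jordan algebra is a multiplicative Hom-algebra $(A,\ast,\alpha)$ such that $x\ast y=y\ast x$ and $(x\ast y)\ast\alpha(z)+(y\ast z)\ast\alpha(x)+(z\ast x)\ast\alpha(y)=0$ for all $x,y,z\in A$. The anti-Hom-associator of a Hom-algebra $(A,\cdot,\alpha)$ is $as^t_\alpha(x,y,z):=(x\cdot y)\cdot\alpha(z)+\alpha(x)\cdot(y\cdot z)$. A left Hom-pre-Jacobi-Jordan algebra is a multiplicative Hom-algebra $(A,\cdot,\alpha)$ with $as^t_\alpha(x,y,z)=-as^t_\alpha(y,x,z)$ for all $x,y,z\in A$. *)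

theory Defs
  imports Complex_Main
begin

text \<open>
  The ground field is the type \<open>'k\<close> and the vector space \<open>A\<close> is the type \<open>'a\<close>
  with scalar multiplication \<open>scale\<close>; dimension is arbitrary.
\<close>

locale hom_algebra = vector_space scale
  for scale :: "'k::field_char_0 \<Rightarrow> 'a::ab_group_add \<Rightarrow> 'a" +
  fixes \<mu> :: "'a \<Rightarrow> 'a \<Rightarrow> 'a"
    and \<alpha> :: "'a \<Rightarrow> 'a"
  assumes linear_twist: "Vector_Spaces.linear scale scale \<alpha>"
    and linear_left: "\<And>y. Vector_Spaces.linear scale scale (\<lambda>x. \<mu> x y)"
    and linear_right: "\<And>x. Vector_Spaces.linear scale scale (\<lambda>y. \<mu> x y)"

locale multiplicative_hom_algebra = hom_algebra scale \<mu> \<alpha>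
  for scale :: "'k::field_char_0 \<Rightarrow> 'a::ab_group_add \<Rightarrow> 'a"
    and \<mu> :: "'a \<Rightarrow> 'a \<Rightarrow> 'a"
    and \<alpha> :: "'a \<Rightarrow> 'a" +
  assumes multiplicative: "\<And>x y. \<alpha> (\<mu> x y) = \<mu> (\<alpha> x) (\<alpha> y)"

locale hom_jacobi_jordan_algebra = multiplicative_hom_algebra scale \<mu> \<alpha>
  for scale :: "'k::field_char_0 \<Rightarrow> 'a::ab_group_add \<Rightarrow> 'a"
    and \<mu> :: "'a \<Rightarrow> 'a \<Rightarrow> 'a"
    and \<alpha> :: "'a \<Rightarrow> 'a" +
  assumes commutative: "\<And>x y. \<mu> x y = \<mu> y x"
    and hom_jacobi:
      "\<And>x y z. \<mu> (\<mu> x y) (\<alpha> z) + \<mu> (\<mu> y z) (\<alpha> x) + \<mu> (\<mu> z x) (\<alpha> y) = 0"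

definition anti_hom_associator ::
    "('a \<Rightarrow> 'a \<Rightarrow> 'a) \<Rightarrow> ('a \<Rightarrow> 'a) \<Rightarrow> 'a \<Rightarrow> 'a \<Rightarrow> 'a \<Rightarrow> 'a::ab_group_add" where
  "anti_hom_associator \<mu> \<alpha> x y z = \<mu> (\<mu> x y) (\<alpha> z) + \<mu> (\<alpha> x) (\<mu> y z)"

locale left_hom_pre_jacobi_jordan_algebra = multiplicative_hom_algebra scale \<mu> \<alpha>
  for scale :: "'k::field_char_0 \<Rightarrow> 'a::ab_group_add \<Rightarrow> 'a"
    and \<mu> :: "'a \<Rightarrow> 'a \<Rightarrow> 'a"
    and \<alpha> :: "'a \<Rightarrow> 'a" +
  assumes left_skew:
    "\<And>x y z. anti_hom_associator \<mu> \<alpha> x y z = - anti_hom_associator \<mu> \<alpha> y x z"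

end

theory Submission
  imports Defs
begin

text \<open>
  Adding the two associators that left skew-symmetry relates turns it into
  \<open>(x \<star> y) \<cdot> \<alpha> z = - (\<alpha> x \<cdot> (y \<cdot> z) + \<alpha> y \<cdot> (x \<cdot> z))\<close>: the operator of left multiplication by
  \<open>x \<star> y\<close> is, up to the twist, the negative anticommutator of those by \<open>x\<close> and \<open>y\<close>.
  In the Jacobi sum of \<open>\<star>\<close>, each summand splits as
  \<open>(x \<star> y) \<star> \<alpha> z = (x \<star> y) \<cdot> \<alpha> z + \<alpha> z \<cdot> (x \<cdot> y) + \<alpha> z \<cdot> (y \<cdot> x)\<close>. Over the three cyclic
  permutations, the last two terms run once through all six products
  \<open>\<alpha> a \<cdot> (b \<cdot> c)\<close> with \<open>a, b, c\<close> a permutation of \<open>x, y, z\<close>, while the identity above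
  writes the first terms as minus the same six products. So the sum vanishes.
\<close>

context hom_algebra
begin

interpretation pair: vector_space_pair scale scale ..

lemma mult_add_left: "\<mu> (x + y) z = \<mu> x z + \<mu> y z"
  by (rule pair.linear_add[OF linear_left])

lemma mult_add_right: "\<mu> z (x + y) = \<mu> z x + \<mu> z y"
  by (rule pair.linear_add[OF linear_right])

lemma twist_add: "\<alpha> (x + y) = \<alpha> x + \<alpha> y"
  by (rule pair.linear_add[OF linear_twist])

lemma hom_algebra_anticommutator: "hom_algebra scale (\<lambda>x y. \<mu> x y + \<mu> y x) \<alpha>"
  by (intro hom_algebra.intro hom_algebra_axioms.intro vector_space_axioms
      linear_twist pair.linear_compose_add linear_left linear_right)

end

lemma (in multiplicative_hom_algebra) multiplicative_hom_algebra_anticommutator: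
  "multiplicative_hom_algebra scale (\<lambda>x y. \<mu> x y + \<mu> y x) \<alpha>"
  by (intro multiplicative_hom_algebra.intro multiplicative_hom_algebra_axioms.intro
      hom_algebra_anticommutator) (simp add: twist_add multiplicative)

context left_hom_pre_jacobi_jordan_algebra
begin

text \<open>
  This is left skew-symmetry solved for the two terms in which the product of the first
  two arguments is the left factor.
\<close>

lemma anticommutator_mult_twist:
  "\<mu> (\<mu> x y + \<mu> y x) (\<alpha> z) = - (\<mu> (\<alpha> x) (\<mu> y z) + \<mu> (\<alpha> y) (\<mu> x z))"
  using left_skew[of x y z]
  by (simp add: anti_hom_associator_def mult_add_left algebra_simps eq_neg_iff_add_eq_0)

end

theorem proposition4p6:
  fixes scale :: "'k::field_char_0 \<Rightarrow> 'a::ab_group_add \<Rightarrow> 'a"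
    and \<mu> :: "'a \<Rightarrow> 'a \<Rightarrow> 'a"
    and \<alpha> :: "'a \<Rightarrow> 'a"
  assumes "left_hom_pre_jacobi_jordan_algebra scale \<mu> \<alpha>"
  shows "hom_jacobi_jordan_algebra scale (\<lambda>x y. \<mu> x y + \<mu> y x) \<alpha>"
proof -
  interpret left_hom_pre_jacobi_jordan_algebra scale \<mu> \<alpha> by (fact assms)
  show ?thesis
    by (intro hom_jacobi_jordan_algebra.intro hom_jacobi_jordan_algebra_axioms.intro
        multiplicative_hom_algebra_anticommutator)
      (simp_all only: anticommutator_mult_twist mult_add_right, simp_all add: algebra_simps)
qed

end
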